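(* For any pair of adjoint bases $(\mathbf{P},\mathbf{Q})$ of $\mathbf{FQSym}$, one has $$\left\langle\prod_{i,j}\frac{1}{1-x_{ij}}\right\rangle=\sum_{\mathrm{std}(v)=\mathrm{std}(u)^{-1}}u\otimes v=\sum_{\sigma}\mathbf{F}_\sigma\otimes\mathbf{G}_\sigma=\sum_\sigma \mathbf{P}_\sigma\otimes\mathbf{Q}_\sigma,$$ where the second sum is over pairs of words $(u,v)$ of the same length with $\mathrm{std}(v)=\mathrm{std}(u)^{-1}$, and the last two sums are over all permutations $\sigma\in\bigsqcup_{n\ge 0}\mathfrak{S}_n$.
   Context: $\mathbb{K}$ is a field of characteristic $0$, $A=\{a_1<a_2<\cdots\}$ an infinite totally ordered alphabet of noncommuting letters (letters $a_i$ are identified with their indices $i$), $\mathbb{K}\langle\langle A\rangle\rangle$ the algebra of noncommutative formal power series; infinite sums in (completed) tensor products are understood formally. Standardization: for a word $w$ of length $m$, $\mathrm{std}(w)\in\mathfrak{S}_m$ is the permutation obtained by labelling the occurrences of the smallest letter from left to right by $1,2,\dots$, then continuing with the occurrences of the next letter from left to right, and so on. For a permutation $\sigma$, $\mathbf{G}_\sigma=\sum_{\mathrm{std}(w)=\sigma}w$ and $\mathbf{F}_\sigma=\mathbf{G}_{\sigma^{-1}}=\sum_{\mathrm{std}(w)=\sigma^{-1}}w$. $\mathbf{FQSym}$ is the algebra with linear basis $(\mathbf{F}_\sigma)$, $\sigma\in\bigsqcup_{n\geq0}\mathfrak{S}_n$, graded by the length $n$ of permutations. Its scalar product is defined by $\langle\mathbf{F}_\sigma,\mathbf{G}_\tau\rangle=\delta_{\sigma,\tau}$.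 A pair of adjoint bases $(\mathbf{P},\mathbf{Q})$ consists of two homogeneous bases $(\mathbf{P}_\sigma)$, $(\mathbf{Q}_\sigma)$ of $\mathbf{FQSym}$, with $\mathbf P_\sigma,\mathbf Q_\sigma$ of degree $n$ for $\sigma\in\mathfrak{S}_n$, such that $\langle\mathbf{P}_\sigma,\mathbf{Q}_\tau\rangle=\delta_{\sigma,\tau}$. Let $x_{ij}=\binom ij$ ($i,j\ge1$) be commuting indeterminates. For words $u=i_1\cdots i_r$, $v=j_1\cdots j_r$ of the same length, the bimonomial $\binom uv$ is the monomial $x_{i_1j_1}\cdots x_{i_rj_r}$. Sorting its columns $\binom{i_k}{j_k}$ lexicographically with priority on the top row gives a biword with rows $u',v'$; sorting them lexicographically with priority on the bottom row gives a biword with rows $u'',v''$. $\langle\ \rangle$ denotes the linear map (compatible with infinite sums) from $\mathbb{K}[[x_{ij}]]$ to the completed tensor product $\mathbb{K}\langle\langle A\rangle\rangle\otimes\mathbb{K}\langle\langle A\rangle\rangle$ defined by $\left\langle\binom uv\right\rangle=u''\otimes v'$. *)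

theory Defs
  imports
    Complex_Main
    "HOL-Library.Multiset"
    "HOL-Library.Product_Lexorder"
    "HOL-Combinatorics.Permutations"
begin

section \<open>Formal series over a set of monomials\<close>

text \<open>
  A formal series is an arbitrary family of coefficients indexed by monomials. With
  \<^item> words as monomials this is the space \<open>\<bbbK>\<langle>\<langle>A\<rangle>\<rangle>\<close>,
  \<^item> pairs of words as monomials it is the completed tensor product of two copies of it,
  \<^item> multisets of index pairs \<open>(i, j)\<close> as monomials it is \<open>\<bbbK>[[x\<^sub>i\<^sub>j]]\<close>.
\<close>

typedef ('m, 'k) series = "UNIV :: ('m \<Rightarrow> 'k) set"
  morphisms coeff Series ..

lemma coeff_Series [simp]: "coeff (Series f) = f"
  by (simp add: Series_inverse)

lemma series_eqI: "(\<And>m. coeff f m = coeff g m) \<Longrightarrow> f = g"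
  by (metis coeff_inverse ext)

instantiation series :: (type, ab_group_add) ab_group_add
begin

definition "0 = Series (\<lambda>_. 0)"
definition "f + g = Series (\<lambda>m. coeff f m + coeff g m)"
definition "f - g = Series (\<lambda>m. coeff f m - coeff g m)"
definition "- f = Series (\<lambda>m. - coeff f m)"

instance
  by standard
    (auto intro!: series_eqI simp: zero_series_def plus_series_def minus_series_def uminus_series_def)

end

lemma coeff_zero [simp]: "coeff 0 m = 0"
  by (simp add: zero_series_def)

lemma coeff_add [simp]: "coeff (f + g) m = coeff f m + coeff g m"
  by (simp add: plus_series_def)

lemma coeff_minus [simp]: "coeff (f - g) m = coeff f m - coeff g m"
  by (simp add: minus_series_def)

lemma coeff_uminus [simp]: "coeff (- f) m = - coeff f m"
  by (simp add: uminus_series_def)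

lemma coeff_sum [simp]: "coeff (sum f I) m = (\<Sum>i\<in>I. coeff (f i) m)"
  by (induction I rule: infinite_finite_induct) auto

definition scale :: "'k::field \<Rightarrow> ('m, 'k) series \<Rightarrow> ('m, 'k) series" where
  "scale c f = Series (\<lambda>m. c * coeff f m)"

lemma coeff_scale [simp]: "coeff (scale c f) m = c * coeff f m"
  by (simp add: scale_def)

global_interpretation series: vector_space "scale :: 'k::field \<Rightarrow> ('m, 'k) series \<Rightarrow> _"
  by standard (auto intro!: series_eqI simp: algebra_simps)

definition monomial :: "'m \<Rightarrow> ('m, 'k::zero_neq_one) series" where
  "monomial m = Series (\<lambda>m'. if m' = m then 1 else 0)"

lemma coeff_monomial [simp]: "coeff (monomial m) m' = (if m' = m then 1 else 0)"
  by (simp add: monomial_def)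

text \<open>
  The Cauchy product of commutative series makes sense as soon as every monomial has only
  finitely many factorizations (the monoid of monomials is written additively).
\<close>

class finite_decomp_monoid = comm_monoid_add +
  assumes finite_decomp: "finite {(a, b). a + b = m}"

instance multiset :: (type) finite_decomp_monoid
proof
  fix m :: "'a multiset"
  have "{(a, b). a + b = m} \<subseteq> {a. a \<subseteq># m} \<times> {b. b \<subseteq># m}"
    by auto
  moreover have "finite {a. a \<subseteq># m}"
  proof (induction m)
    case (add x m)
    have "{a. a \<subseteq># add_mset x m} \<subseteq> {a. a \<subseteq># m} \<union> add_mset x ` {a. a \<subseteq># m}"
    proof
      fix a assume a: "a \<in> {a. a \<subseteq># add_mset x m}"
      show "a \<in> {a. a \<subseteq># m} \<union> add_mset x ` {a. a \<subseteq># m}"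
      proof (cases "x \<in># a")
        case True
        then obtain b where "a = add_mset x b" by (meson multi_member_split)
        with a show ?thesis by auto
      next
        case False
        have "a - {#x#} \<subseteq># m" using a by (simp add: subset_eq_diff_conv)
        with False show ?thesis by (simp add: diff_single_trivial)
      qed
    qed
    with add show ?case by (meson finite_UnI finite_imageI finite_subset)
  qed simp
  ultimately show "finite {(a, b). a + b = m}"
    by (meson finite_SigmaI finite_subset)
qed

instantiation series :: (finite_decomp_monoid, comm_ring_1) comm_ring_1
begin

definition "1 = Series (\<lambda>m. if m = 0 then 1 else 0)"
definition "f * g = Series (\<lambda>m. \<Sum>(a, b)\<in>{(a, b). a + b = m}. coeff f a * coeff g b)"

instance
proof
  fix f g h :: "('a, 'b) series"
  show "f * g * h = f * (g * h)"
  proof (rule series_eqI)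
    fix m :: 'a
    let ?D = "\<lambda>m::'a. {(a, b). a + b = m}"
    have "coeff (f * g * h) m
        = (\<Sum>z\<in>?D m. \<Sum>y\<in>?D (fst z). coeff f (fst y) * coeff g (snd y) * coeff h (snd z))"
      by (simp add: times_series_def sum_distrib_right case_prod_unfold)
    also have "\<dots> = (\<Sum>(z, y)\<in>(SIGMA z:?D m. ?D (fst z)).
        coeff f (fst y) * coeff g (snd y) * coeff h (snd z))"
      by (rule sum.Sigma) (auto simp: finite_decomp)
    also have "\<dots> = (\<Sum>(z, y)\<in>(SIGMA z:?D m. ?D (snd z)).
        coeff f (fst z) * (coeff g (fst y) * coeff h (snd y)))"
      by (rule sum.reindex_bij_witness
          [where i = "\<lambda>(z, y). ((fst z + fst y, snd y), (fst z, fst y))"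
             and j = "\<lambda>(z, y). ((fst y, snd y + snd z), (snd y, snd z))"])
        (auto simp: add.assoc mult.assoc)
    also have "\<dots> = (\<Sum>z\<in>?D m. \<Sum>y\<in>?D (snd z).
        coeff f (fst z) * (coeff g (fst y) * coeff h (snd y)))"
      by (rule sum.Sigma [symmetric]) (auto simp: finite_decomp)
    also have "\<dots> = coeff (f * (g * h)) m"
      by (simp add: times_series_def sum_distrib_left case_prod_unfold)
    finally show "coeff (f * g * h) m = coeff (f * (g * h)) m" .
  qed
  show "f * g = g * f"
    unfolding times_series_def
    by (rule arg_cong [where f = Series], rule ext)
      (rule sum.reindex_bij_witness [where i = prod.swap and j = prod.swap],
       auto simp: add.commute mult.commute)
  show "1 * f = f"
  proof (rule series_eqI)
    fix m :: 'a
    have "coeff (1 * f) m = (\<Sum>z\<in>{(a, b). a + b = m}. if z = (0, m) then coeff f m else 0)"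
      by (auto simp: times_series_def one_series_def intro!: sum.cong)
    also have "\<dots> = coeff f m"
      by (simp add: sum.delta finite_decomp)
    finally show "coeff (1 * f) m = coeff f m" .
  qed
  show "(f + g) * h = f * h + g * h"
    by (rule series_eqI)
      (simp add: times_series_def algebra_simps case_prod_unfold sum.distrib)
  show "(0::('a, 'b) series) \<noteq> 1"
  proof
    assume "(0::('a, 'b) series) = 1"
    then have "coeff (0::('a, 'b) series) 0 = coeff 1 0" by simp
    then show False by (simp add: one_series_def)
  qed
qed

end

text \<open>Reciprocals are only meaningful for invertible series.\<close>

instantiation series :: (finite_decomp_monoid, comm_ring_1) inverse
begin

definition "inverse (f :: ('a, 'b) series) = (THE g. f * g = 1)"
definition "(f :: ('a, 'b) series) div g = f * inverse g"

instance ..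

end

text \<open>
  Formal infinite sums and products: every coefficient of the finite partial sums (products) is
  eventually constant, along the directed set of finite subsets of the index set.
\<close>

definition formal_has_sum ::
    "('i \<Rightarrow> ('m, 'k::ab_group_add) series) \<Rightarrow> 'i set \<Rightarrow> ('m, 'k) series \<Rightarrow> bool" where
  "formal_has_sum f I s \<longleftrightarrow>
     (\<forall>m. \<forall>\<^sub>F S in finite_subsets_at_top I. coeff (\<Sum>i\<in>S. f i) m = coeff s m)"

definition formal_sum ::
    "('i \<Rightarrow> ('m, 'k::ab_group_add) series) \<Rightarrow> 'i set \<Rightarrow> ('m, 'k) series" where
  "formal_sum f I = (THE s. formal_has_sum f I s)"

definition formal_has_prod ::
    "('i \<Rightarrow> ('m::finite_decomp_monoid, 'k::comm_ring_1) series) \<Rightarrow> 'i set \<Rightarrow> ('m, 'k) series \<Rightarrow> bool"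
  where
  "formal_has_prod f I p \<longleftrightarrow>
     (\<forall>m. \<forall>\<^sub>F S in finite_subsets_at_top I. coeff (\<Prod>i\<in>S. f i) m = coeff p m)"

definition formal_multipliable ::
    "('i \<Rightarrow> ('m::finite_decomp_monoid, 'k::comm_ring_1) series) \<Rightarrow> 'i set \<Rightarrow> bool" where
  "formal_multipliable f I \<longleftrightarrow> (\<exists>p. formal_has_prod f I p)"

definition formal_prod ::
    "('i \<Rightarrow> ('m::finite_decomp_monoid, 'k::comm_ring_1) series) \<Rightarrow> 'i set \<Rightarrow> ('m, 'k) series" where
  "formal_prod f I = (THE p. formal_has_prod f I p)"

lemma formal_has_sum_unique:
  assumes "formal_has_sum f I s" "formal_has_sum f I t"
  shows "s = t"
proof (rule series_eqI)
  fix m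
  have "\<forall>\<^sub>F S in finite_subsets_at_top I. coeff s m = coeff t m"
    using assms[unfolded formal_has_sum_def, rule_format, of m]
    by eventually_elim simp
  then show "coeff s m = coeff t m" by simp
qed

lemma formal_sum_eqI: "formal_has_sum f I s \<Longrightarrow> formal_sum f I = s"
  unfolding formal_sum_def by (blast intro: formal_has_sum_unique)

lemma formal_has_prod_unique:
  assumes "formal_has_prod f I p" "formal_has_prod f I q"
  shows "p = q"
proof (rule series_eqI)
  fix m
  have "\<forall>\<^sub>F S in finite_subsets_at_top I. coeff p m = coeff q m"
    using assms[unfolded formal_has_prod_def, rule_format, of m]
    by eventually_elim simp
  then show "coeff p m = coeff q m" by simp
qed

lemma formal_prod_eqI: "formal_has_prod f I p \<Longrightarrow> formal_prod f I = p"
  unfolding formal_prod_def by (blast intro: formal_has_prod_unique)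

lemma formal_has_sumI:
  assumes "\<And>m. finite {i \<in> I. coeff (f i) m \<noteq> 0}"
    and "\<And>m. coeff s m = (\<Sum>i | i \<in> I \<and> coeff (f i) m \<noteq> 0. coeff (f i) m)"
  shows "formal_has_sum f I s"
  unfolding formal_has_sum_def
proof
  fix m
  let ?T = "{i \<in> I. coeff (f i) m \<noteq> 0}"
  have "coeff (\<Sum>i\<in>S. f i) m = coeff s m" if "finite S" "?T \<subseteq> S" "S \<subseteq> I" for S
    using that by (auto simp: assms(2) intro!: sum.mono_neutral_right)
  then show "\<forall>\<^sub>F S in finite_subsets_at_top I. coeff (\<Sum>i\<in>S. f i) m = coeff s m"
    unfolding eventually_finite_subsets_at_top using assms(1)[of m]
    by (intro exI[of _ ?T]) auto
qed


section \<open>Words and free quasi-symmetric functions\<close>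

text \<open>
  The alphabet \<open>a\<^sub>1 < a\<^sub>2 < \<dots>\<close> is the ordered set \<^typ>\<open>nat\<close>: the number \<open>i\<close> stands for the
  letter \<open>a\<^bsub>i+1\<^esub>\<close>. Permutations in \<open>\<SS>\<^sub>n\<close> are functions that permute \<open>{1..n}\<close>; since the
  identity function permutes every \<open>{1..n}\<close>, the disjoint union of all \<open>\<SS>\<^sub>n\<close> consists of pairs
  \<open>(n, \<sigma>)\<close>, and families indexed by it are curried.
\<close>

type_synonym 'k ncseries = "(nat list, 'k) series"
type_synonym 'k tensor_series = "(nat list \<times> nat list, 'k) series"
type_synonym 'k xseries = "((nat \<times> nat) multiset, 'k) series"

definition Perms :: "(nat \<times> (nat \<Rightarrow> nat)) set" where
  "Perms = (SIGMA n:UNIV. {\<sigma>. \<sigma> permutes {1..n}})"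

text \<open>
  The label of position \<open>k\<close> is the number of positions labelled not later than \<open>k\<close>: those
  carrying a smaller letter, and those carrying the same letter weakly to the left of \<open>k\<close>.
  Positions are counted from 1.
\<close>

definition std :: "nat list \<Rightarrow> nat \<Rightarrow> nat" where
  "std w k =
     (if k \<in> {1..length w}
      then card {l \<in> {1..length w}.
             w ! (l - 1) < w ! (k - 1) \<or> w ! (l - 1) = w ! (k - 1) \<and> l \<le> k}
      else k)"

lemma std_permutes: "std w permutes {1..length w}"
proof -
  let ?n = "length w"
  let ?A = "\<lambda>k. {l \<in> {1..?n}. w ! (l - 1) < w ! (k - 1) \<or> w ! (l - 1) = w ! (k - 1) \<and> l \<le> k}"
  have less: "std w k < std w l"
    if "k \<in> {1..?n}" "l \<in> {1..?n}"
      and "w ! (k - 1) < w ! (l - 1) \<or> w ! (k - 1) = w ! (l - 1) \<and> k < l" for k l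
  proof -
    have "?A k \<subset> ?A l" using that by auto
    then have "card (?A k) < card (?A l)" by (intro psubset_card_mono) auto
    then show ?thesis using that unfolding std_def by simp
  qed
  have inj: "inj_on (std w) {1..?n}"
  proof (rule inj_onI, rule ccontr)
    fix k l assume kl: "k \<in> {1..?n}" "l \<in> {1..?n}" "std w k = std w l" "k \<noteq> l"
    then consider "w ! (k - 1) < w ! (l - 1) \<or> w ! (k - 1) = w ! (l - 1) \<and> k < l"
      | "w ! (l - 1) < w ! (k - 1) \<or> w ! (l - 1) = w ! (k - 1) \<and> l < k"
      by linarith
    then show False using less kl by cases (metis less_irrefl)+
  qed
  have "std w k \<in> {1..?n}" if "k \<in> {1..?n}" for k
  proof -
    have "card (?A k) \<le> card {1..?n}" by (rule card_mono) auto
    moreover have "k \<in> ?A k" using that by simp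
    then have "card (?A k) > 0" by (auto simp: card_gt_0_iff)
    ultimately show ?thesis using that unfolding std_def by simp
  qed
  then have "std w ` {1..?n} = {1..?n}"
    using inj by (intro endo_inj_surj) auto
  with inj have "bij_betw (std w) {1..?n} {1..?n}" by (simp add: bij_betw_def)
  then show ?thesis by (rule bij_imp_permutes) (auto simp: std_def)
qed

definition G :: "nat \<Rightarrow> (nat \<Rightarrow> nat) \<Rightarrow> 'k::field_char_0 ncseries" where
  "G n \<sigma> = formal_sum monomial {w. length w = n \<and> std w = \<sigma>}"

definition F :: "nat \<Rightarrow> (nat \<Rightarrow> nat) \<Rightarrow> 'k::field_char_0 ncseries" where
  "F n \<sigma> = G n (inv \<sigma>)"

lemma coeff_G [simp]: "coeff (G n \<sigma>) w = (if length w = n \<and> std w = \<sigma> then 1 else 0)"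
proof -
  let ?I = "{w. length w = n \<and> std w = \<sigma>}"
  let ?s = "Series (\<lambda>w. if w \<in> ?I then 1 else 0) :: 'a ncseries"
  have *: "{v \<in> ?I. coeff (monomial v :: 'a ncseries) w \<noteq> 0} = (if w \<in> ?I then {w} else {})" for w
    by auto
  have "formal_has_sum monomial ?I ?s"
    by (rule formal_has_sumI) (simp_all only: *, auto)
  then have "G n \<sigma> = ?s" unfolding G_def by (rule formal_sum_eqI)
  then show ?thesis by simp
qed

lemma coeff_F [simp]: "coeff (F n \<sigma>) w = (if length w = n \<and> std w = inv \<sigma> then 1 else 0)"
  by (simp add: F_def)

lemma std_permutation_word:
  assumes "\<sigma> permutes {1..n}"
  shows "std (map \<sigma> [1..<Suc n]) = \<sigma>"
proof
  fix k
  show "std (map \<sigma> [1..<Suc n]) k = \<sigma> k"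
  proof (cases "k \<in> {1..n}")
    case True
    have nth: "map \<sigma> [1..<Suc n] ! (l - 1) = \<sigma> l" if "l \<in> {1..n}" for l
      using that by (auto simp del: upt_Suc)
    have inj: "inj \<sigma>" using assms by (rule permutes_inj)
    have "{l \<in> {1..n}. map \<sigma> [1..<Suc n] ! (l - 1) < map \<sigma> [1..<Suc n] ! (k - 1) \<or>
            map \<sigma> [1..<Suc n] ! (l - 1) = map \<sigma> [1..<Suc n] ! (k - 1) \<and> l \<le> k}
        = {l \<in> {1..n}. \<sigma> l \<le> \<sigma> k}"
      using nth True inj by (auto simp: inj_eq simp del: upt_Suc)
    moreover have "\<sigma> ` {l \<in> {1..n}. \<sigma> l \<le> \<sigma> k} = {1..\<sigma> k}"
    proof -
      have "\<sigma> k \<le> n" using permutes_in_image[OF assms, of k] True by auto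
      moreover have "\<sigma> ` {1..n} = {1..n}" using assms by (rule permutes_image)
      ultimately show ?thesis
      proof (intro equalityI subsetI)
        fix y assume "y \<in> {1..\<sigma> k}"
        with \<open>\<sigma> k \<le> n\<close> have "y \<in> \<sigma> ` {1..n}" "y \<le> \<sigma> k"
          unfolding \<open>\<sigma> ` {1..n} = {1..n}\<close> by auto
        then show "y \<in> \<sigma> ` {l \<in> {1..n}. \<sigma> l \<le> \<sigma> k}" by blast
      next
        fix y assume "y \<in> \<sigma> ` {l \<in> {1..n}. \<sigma> l \<le> \<sigma> k}"
        then have "y \<in> \<sigma> ` {1..n}" "y \<le> \<sigma> k" by auto
        then show "y \<in> {1..\<sigma> k}" unfolding \<open>\<sigma> ` {1..n} = {1..n}\<close> by simp
      qed
    qed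
    then have "card {l \<in> {1..n}. \<sigma> l \<le> \<sigma> k} = \<sigma> k"
      using card_image[OF inj_on_subset[OF inj subset_UNIV], of "{l \<in> {1..n}. \<sigma> l \<le> \<sigma> k}"]
      by simp
    moreover have "k \<in> {1..length (map \<sigma> [1..<Suc n])}" using True by simp
    ultimately show ?thesis unfolding std_def by (simp only: if_True length_map length_upt) simp
  next
    case False
    then have "k \<notin> {1..length (map \<sigma> [1..<Suc n])}" by simp
    then have "std (map \<sigma> [1..<Suc n]) k = k" unfolding std_def by (rule if_not_P)
    then show ?thesis using permutes_not_in[OF assms False] by simp
  qed
qed

definition FQSym :: "'k::field_char_0 ncseries set" where
  "FQSym = series.span {F n \<sigma> |n \<sigma>. \<sigma> permutes {1..n}}"

definition FQSym_deg :: "nat \<Rightarrow> 'k::field_char_0 ncseries set" where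
  "FQSym_deg n = series.span {F n \<sigma> |\<sigma>. \<sigma> permutes {1..n}}"

definition homogeneous_basis :: "(nat \<Rightarrow> (nat \<Rightarrow> nat) \<Rightarrow> 'k::field_char_0 ncseries) \<Rightarrow> bool" where
  "homogeneous_basis B \<longleftrightarrow>
     (\<forall>(n, \<sigma>)\<in>Perms. B n \<sigma> \<in> FQSym_deg n) \<and>
     inj_on (\<lambda>(n, \<sigma>). B n \<sigma>) Perms \<and>
     series.independent ((\<lambda>(n, \<sigma>). B n \<sigma>) ` Perms) \<and>
     series.span ((\<lambda>(n, \<sigma>). B n \<sigma>) ` Perms) = FQSym"

definition basis_coord ::
    "(nat \<Rightarrow> (nat \<Rightarrow> nat) \<Rightarrow> 'k::field_char_0 ncseries) \<Rightarrow> 'k ncseries \<Rightarrow> nat \<times> (nat \<Rightarrow> nat) \<Rightarrow> 'k"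
  where
  "basis_coord B f = (\<lambda>(n, \<sigma>). series.representation ((\<lambda>(n, \<sigma>). B n \<sigma>) ` Perms) f (B n \<sigma>))"

text \<open>The bilinear form on \<^const>\<open>FQSym\<close> for which the bases \<^const>\<open>F\<close> and \<^const>\<open>G\<close> are dual.\<close>

definition fqsym_inner :: "'k::field_char_0 ncseries \<Rightarrow> 'k ncseries \<Rightarrow> 'k" where
  "fqsym_inner f g =
     (\<Sum>s | s \<in> Perms \<and> basis_coord F f s \<noteq> 0. basis_coord F f s * basis_coord G g s)"

lemma inj_on_G: "inj_on (\<lambda>(n, \<sigma>). G n \<sigma> :: 'k::field_char_0 ncseries) Perms"
proof (rule inj_onI, clarify)
  fix m \<sigma> n \<tau>
  assume s: "(m, \<sigma>) \<in> Perms" and eq: "(G m \<sigma> :: 'k ncseries) = G n \<tau>"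
  let ?w = "map \<sigma> [1..<Suc m]"
  have std: "std ?w = \<sigma>" using s by (intro std_permutation_word) (simp add: Perms_def)
  have "coeff (G m \<sigma> :: 'k ncseries) ?w = 1" using std by simp
  then have "coeff (G n \<tau> :: 'k ncseries) ?w = 1" by (simp only: eq)
  with std show "m = n \<and> \<sigma> = \<tau>" by (auto split: if_splits)
qed

lemma independent_G:
  "series.independent ((\<lambda>(n, \<sigma>). G n \<sigma> :: 'k::field_char_0 ncseries) ` Perms)"
proof
  let ?g = "\<lambda>(n, \<sigma>). G n \<sigma> :: 'k ncseries"
  assume "series.dependent (?g ` Perms)"
  then obtain S u v where S: "finite S" "S \<subseteq> ?g ` Perms" "(\<Sum>b\<in>S. scale (u b) b) = 0"
      "v \<in> S" "u v \<noteq> 0"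
    unfolding series.dependent_explicit by auto
  then obtain n \<sigma> where v: "v = G n \<sigma>" "(n, \<sigma>) \<in> Perms" by auto
  let ?w = "map \<sigma> [1..<Suc n]"
  have std: "std ?w = \<sigma>" using v by (intro std_permutation_word) (simp add: Perms_def)
  have "coeff b ?w = (if b = v then 1 else 0)" if "b \<in> S" for b
  proof -
    from that S have "b \<in> ?g ` Perms" by blast
    then obtain m \<tau> where b: "b = G m \<tau>" "(m, \<tau>) \<in> Perms" by auto
    then have "(b = v) = ((m, \<tau>) = (n, \<sigma>))"
      using inj_onD[OF inj_on_G, of "(m, \<tau>)" "(n, \<sigma>)"] v by auto
    then show ?thesis using b std by (auto simp del: upt_Suc)
  qed
  then have "coeff (\<Sum>b\<in>S. scale (u b) b) ?w = (\<Sum>b\<in>S. if b = v then u b else 0)"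
    unfolding coeff_sum coeff_scale by (intro sum.cong) simp_all
  also have "\<dots> = u v" using S by simp
  finally show False using S by simp
qed

lemma F_image_eq_G_image:
  "(\<lambda>(n, \<sigma>). F n \<sigma>) ` Perms = (\<lambda>(n, \<sigma>). G n \<sigma> :: 'k::field_char_0 ncseries) ` Perms"
proof -
  have "(n, inv \<sigma>) \<in> Perms" if "(n, \<sigma>) \<in> Perms" for n \<sigma>
    using that by (auto simp: Perms_def intro: permutes_inv)
  moreover have "G n \<sigma> = F n (inv \<sigma>)" if "(n, \<sigma>) \<in> Perms" for n \<sigma>
    using that by (auto simp: Perms_def F_def permutes_inv_inv)
  ultimately show ?thesis by (force simp: F_def)
qed

lemma inj_on_F: "inj_on (\<lambda>(n, \<sigma>). F n \<sigma> :: 'k::field_char_0 ncseries) Perms"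
proof (rule inj_onI, clarify)
  fix m \<sigma> n \<tau>
  assume s: "(m, \<sigma>) \<in> Perms" "(n, \<tau>) \<in> Perms" and eq: "(F m \<sigma> :: 'k ncseries) = F n \<tau>"
  have "(m, inv \<sigma>) \<in> Perms" "(n, inv \<tau>) \<in> Perms"
    using s by (auto simp: Perms_def intro: permutes_inv)
  with eq have "m = n \<and> inv \<sigma> = inv \<tau>"
    using inj_onD[OF inj_on_G, of "(m, inv \<sigma>)" "(n, inv \<tau>)"] by (auto simp: F_def)
  with s show "m = n \<and> \<sigma> = \<tau>" by (auto simp: Perms_def) (metis permutes_inv_inv)
qed

lemma basis_coord_self:
  assumes "inj_on (\<lambda>(n, \<sigma>). B n \<sigma>) Perms" "series.independent ((\<lambda>(n, \<sigma>). B n \<sigma>) ` Perms)"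
    and "s \<in> Perms" "(n, \<tau>) \<in> Perms"
  shows "basis_coord B (B n \<tau>) s = (if s = (n, \<tau>) then 1 else 0)"
proof -
  obtain m \<sigma> where s: "s = (m, \<sigma>)" by (cases s)
  have "B n \<tau> \<in> (\<lambda>(n, \<sigma>). B n \<sigma>) ` Perms" using assms(4) by force
  moreover have "B m \<sigma> = B n \<tau> \<longleftrightarrow> s = (n, \<tau>)"
    using inj_onD[OF assms(1), of s "(n, \<tau>)"] assms(3,4) s by auto
  ultimately show ?thesis
    by (simp add: basis_coord_def s series.representation_basis[OF assms(2)])
qed

lemma fqsym_inner_F_G:
  assumes "(m, \<sigma>) \<in> Perms" "(n, \<tau>) \<in> Perms"
  shows "fqsym_inner (F m \<sigma>) (G n \<tau> :: 'k::field_char_0 ncseries)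
    = (if (m, \<sigma>) = (n, \<tau>) then 1 else 0)"
proof -
  have F: "basis_coord F (F m \<sigma> :: 'k ncseries) s = (if s = (m, \<sigma>) then 1 else 0)"
    if "s \<in> Perms" for s
    using inj_on_F _ that assms(1) by (rule basis_coord_self) (metis F_image_eq_G_image independent_G)
  have G: "basis_coord G (G n \<tau> :: 'k ncseries) s = (if s = (n, \<tau>) then 1 else 0)"
    if "s \<in> Perms" for s
    using inj_on_G independent_G that assms(2) by (rule basis_coord_self)
  have "{s. s \<in> Perms \<and> basis_coord F (F m \<sigma> :: 'k ncseries) s \<noteq> 0} = {(m, \<sigma>)}"
    using F assms(1) by (auto split: if_splits)
  then show ?thesis using F G assms(1) by (simp add: fqsym_inner_def)
qed

definition adjoint_bases ::
    "(nat \<Rightarrow> (nat \<Rightarrow> nat) \<Rightarrow> 'k::field_char_0 ncseries) \<Rightarrow>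
     (nat \<Rightarrow> (nat \<Rightarrow> nat) \<Rightarrow> 'k ncseries) \<Rightarrow> bool" where
  "adjoint_bases P Q \<longleftrightarrow>
     homogeneous_basis P \<and> homogeneous_basis Q \<and>
     (\<forall>(m, \<sigma>)\<in>Perms. \<forall>(n, \<tau>)\<in>Perms.
        fqsym_inner (P m \<sigma>) (Q n \<tau>) = (if (m, \<sigma>) = (n, \<tau>) then 1 else 0))"

definition tensor :: "'k::field_char_0 ncseries \<Rightarrow> 'k ncseries \<Rightarrow> 'k tensor_series"
    (infixr "\<otimes>" 70) where
  "f \<otimes> g = Series (\<lambda>(u, v). coeff f u * coeff g v)"


section \<open>Bimonomials\<close>

text \<open>The variable \<open>x\<^sub>i\<^sub>j\<close>.\<close>

definition X :: "nat \<Rightarrow> nat \<Rightarrow> 'k::field_char_0 xseries" where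
  "X i j = monomial {#(i, j)#}"

text \<open>
  A monomial in the \<open>x\<^sub>i\<^sub>j\<close> is the multiset of columns \<open>(i, j)\<close> of its biwords. In
  \<open>bottom_row_by_top\<close> (the word \<open>v'\<close>) the columns are sorted lexicographically with priority on
  the top row; in \<open>top_row_by_bottom\<close> (the word \<open>u''\<close>) with priority on the bottom row, by
  swapping the two rows first. The order on pairs is that of
  \<^theory>\<open>HOL-Library.Product_Lexorder\<close>.
\<close>

definition bimonomial :: "nat list \<Rightarrow> nat list \<Rightarrow> (nat \<times> nat) multiset" where
  "bimonomial u v = mset (zip u v)"

definition bottom_row_by_top :: "(nat \<times> nat) multiset \<Rightarrow> nat list" where
  "bottom_row_by_top M = map snd (sorted_list_of_multiset M)"

definition top_row_by_bottom :: "(nat \<times> nat) multiset \<Rightarrow> nat list" where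
  "top_row_by_bottom M = map snd (sorted_list_of_multiset (image_mset prod.swap M))"

definition bracket :: "'k::field_char_0 xseries \<Rightarrow> 'k tensor_series" where
  "bracket f =
     formal_sum
       (\<lambda>M. scale (coeff f M) (monomial (top_row_by_bottom M) \<otimes> monomial (bottom_row_by_top M)))
       UNIV"

lemma bracket_bimonomial:
  "bracket (monomial (bimonomial u v)) =
     monomial (top_row_by_bottom (bimonomial u v)) \<otimes> monomial (bottom_row_by_top (bimonomial u v))"
  (is "_ = ?t")
proof -
  let ?M = "bimonomial u v"
  let ?f = "\<lambda>M. scale (coeff (monomial ?M) M)
    (monomial (top_row_by_bottom M) \<otimes> monomial (bottom_row_by_top M)) :: 'a tensor_series"
  have f: "coeff (?f M) m = (if M = ?M then coeff ?t m else 0)" for M m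
    by simp
  have *: "{M \<in> UNIV. coeff (?f M) m \<noteq> 0} = (if coeff ?t m = 0 then {} else {?M})" for m
    unfolding f by auto
  have "formal_has_sum ?f UNIV ?t"
    by (rule formal_has_sumI) (simp_all only: *, auto)
  then show ?thesis unfolding bracket_def by (rule formal_sum_eqI)
qed

end

theory Submission
  imports Defs
begin

text \<open>
  Expanding the geometric series shows that the product is the sum of all monomials
  in the \<open>x\<^sub>i\<^sub>j\<close>, each with coefficient 1 (lemma \<open>cauchy_product\<close>). Its image under the bracket
  counts, for each pair of words \<open>(u, v)\<close>, the multisets of columns \<open>M\<close> with \<open>u = u''\<close> and
  \<open>v = v'\<close>, where \<open>u''\<close> is \<open>top_row_by_bottom M\<close> and \<open>v'\<close> is \<open>bottom_row_by_top M\<close>. The point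
  is that \<open>M \<mapsto> (u'', v')\<close> is a bijection from the multisets of columns onto the pairs with
  \<open>std v = (std u)\<^sup>-\<^sup>1\<close>.

  For a column standing at position \<open>k\<close> when the top row has priority, \<open>std v' k\<close> is its position
  when the bottom row has priority; \<open>std u''\<close> describes the way back, so the two permutations
  are inverse to each other (\<open>std_bracket_rows\<close>). Conversely, given such a pair \<open>(u, v)\<close>, the
  columns that put \<open>v\<^sub>k\<close> below the letter of \<open>u\<close> at position \<open>std v k\<close> are already sorted
  (\<open>bracket_rows_surj\<close>), and \<open>M\<close> can be read off from its two rows because sorting \<open>u''\<close> gives
  the top row \<open>u'\<close> (\<open>bracket_rows_determine\<close>). So the bracket of the product is the indicator
  series \<open>cauchy_kernel\<close> of these pairs. The sum over pairs of words and the sum of the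
  \<open>F\<^sub>\<sigma> \<otimes> G\<^sub>\<sigma>\<close> only split this indicator series according to partitions of its support.

  For a pair of adjoint bases, the coefficient of a word \<open>u\<close> in an element \<open>f\<close> of \<open>FQSym\<close> is
  \<open>\<langle>f, G\<^sub>\<beta>\<rangle>\<close> with \<open>\<beta> = (std u)\<^sup>-\<^sup>1\<close> (\<open>fqsym_inner_G\<close>). Hence
  \<open>\<Sum>\<^sub>\<sigma> P\<^sub>\<sigma>(u) Q\<^sub>\<sigma> = \<Sum>\<^sub>\<sigma> \<langle>P\<^sub>\<sigma>, G\<^sub>\<beta>\<rangle> Q\<^sub>\<sigma> = G\<^sub>\<beta>\<close>
  by adjointness, and the coefficient of \<open>v\<close> in \<open>G\<^sub>\<beta>\<close> is the one of \<open>u \<otimes> v\<close> in the kernel. The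
  middle sum is finite, which also gives the convergence of the sum of the \<open>P\<^sub>\<sigma> \<otimes> Q\<^sub>\<sigma>\<close>.
\<close>

section \<open>The Cauchy product\<close>

lemma one_minus_monomial_mult:
  "coeff ((1 - monomial {#p#}) * f) M
    = coeff f M - (if p \<in># M then coeff f (M - {#p#}) else (0 :: 'k::comm_ring_1))"
proof -
  have *: "coeff (monomial {#p#} * f) M = (if p \<in># M then coeff f (M - {#p#}) else 0)"
  proof -
    have "coeff (monomial {#p#} * f) M
        = (\<Sum>z\<in>{(a, b). a + b = M}. if fst z = {#p#} then coeff f (snd z) else 0)"
      by (simp add: times_series_def case_prod_unfold if_distrib [of "\<lambda>c. c * _"] cong: if_cong)
    also have "\<dots> = (\<Sum>z\<in>{z \<in> {(a, b). a + b = M}. fst z = {#p#}}. coeff f (snd z))"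
      by (rule sum.inter_filter [symmetric]) (rule finite_decomp)
    also have "{z \<in> {(a, b). a + b = M}. fst z = {#p#}}
        = (if p \<in># M then {({#p#}, M - {#p#})} else {})"
      by auto
    finally show ?thesis by simp
  qed
  show ?thesis by (simp only: left_diff_distrib mult_1_left coeff_minus *)
qed

definition all_monomials :: "'a set \<Rightarrow> ('a multiset, 'k::comm_ring_1) series" where
  "all_monomials S = Series (\<lambda>M. if set_mset M \<subseteq> S then 1 else 0)"

text \<open>
  A monomial over \<open>insert p S\<close> either avoids \<open>p\<close> or arises from another one by one factor \<open>p\<close>;
  multiplying by \<open>1 - p\<close> cancels the latter. This one identity yields both the geometric
  series (for \<open>S = {}\<close>) and the step from \<open>S\<close> to \<open>insert p S\<close> in the product.
\<close>

lemma all_monomials_insert: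
  assumes "p \<notin> S"
  shows "(1 - monomial {#p#}) * all_monomials (insert p S) = all_monomials S"
proof (rule series_eqI)
  fix M :: "'a multiset"
  show "coeff ((1 - monomial {#p#}) * all_monomials (insert p S)) M
      = coeff (all_monomials S :: ('a multiset, 'b) series) M"
  proof (cases "p \<in># M")
    case True
    then obtain N where "M = add_mset p N" by (meson multi_member_split)
    with assms show ?thesis
      unfolding one_minus_monomial_mult by (auto simp: all_monomials_def)
  next
    case False
    then show ?thesis
      unfolding one_minus_monomial_mult by (auto simp: all_monomials_def)
  qed
qed

lemma all_monomials_empty: "all_monomials {} = 1"
  by (rule series_eqI) (simp add: all_monomials_def one_series_def)

lemma inverse_series_eqI:
  fixes f g :: "('m::finite_decomp_monoid, 'k::comm_ring_1) series"
  assumes "f * g = 1"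
  shows "inverse f = g"
  unfolding inverse_series_def
proof (rule the_equality)
  fix h assume "f * h = 1"
  then have "g = (f * h) * g" by simp
  also have "\<dots> = (f * g) * h" by (simp only: mult_ac)
  finally show "h = g" using assms by simp
qed (fact assms)

lemma inverse_one_minus_monomial:
  "inverse (1 - monomial {#p#}) = (all_monomials {p} :: ('a multiset, 'k::comm_ring_1) series)"
  by (rule inverse_series_eqI)
    (simp only: all_monomials_insert [of p "{}"] all_monomials_empty empty_iff not_False_eq_True)

lemma prod_geometric_series:
  assumes "finite S"
  shows "(\<Prod>p\<in>S. 1 / (1 - monomial {#p#})) = (all_monomials S :: ('a multiset, 'k::comm_ring_1) series)"
  using assms
proof (induction S rule: finite_induct)
  case empty
  then show ?case by (simp add: all_monomials_empty)
next
  case (insert p S)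
  let ?g = "all_monomials {p} :: ('a multiset, 'k) series"
  have g: "1 / (1 - monomial {#p#}) = ?g"
    by (simp add: divide_series_def inverse_one_minus_monomial)
  have inv: "(1 - monomial {#p#}) * ?g = 1"
    using all_monomials_insert [of p "{}"] by (simp add: all_monomials_empty)
  have "?g * all_monomials S = ?g * ((1 - monomial {#p#}) * all_monomials (insert p S))"
    by (simp only: all_monomials_insert [OF insert.hyps(2)])
  also have "\<dots> = ((1 - monomial {#p#}) * ?g) * all_monomials (insert p S)"
    by (simp only: mult_ac)
  also have "\<dots> = all_monomials (insert p S)" by (simp only: inv mult_1_left)
  finally show ?case by (simp only: prod.insert [OF insert.hyps] g insert.IH)
qed

lemma cauchy_product:
  "formal_has_prod (\<lambda>(i, j). 1 / (1 - X i j) :: 'k::field_char_0 xseries) UNIV (Series (\<lambda>_. 1))"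
  unfolding formal_has_prod_def
proof
  fix M :: "(nat \<times> nat) multiset"
  have "coeff (\<Prod>(i, j)\<in>S. 1 / (1 - X i j) :: 'k xseries) M = coeff (Series (\<lambda>_. 1)) M"
    if "finite S" "set_mset M \<subseteq> S" for S
  proof -
    have "(\<Prod>(i, j)\<in>S. 1 / (1 - X i j) :: 'k xseries) = all_monomials S"
      using prod_geometric_series [OF that(1)] by (simp add: X_def case_prod_unfold)
    with that show ?thesis by (simp add: all_monomials_def)
  qed
  then show "\<forall>\<^sub>F S in finite_subsets_at_top UNIV.
      coeff (\<Prod>(i, j)\<in>S. 1 / (1 - X i j) :: 'k xseries) M = coeff (Series (\<lambda>_. 1)) M"
    unfolding eventually_finite_subsets_at_top by (intro exI [of _ "set_mset M"]) auto
qed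


section \<open>Standardization\<close>

lemma std_less_iff:
  assumes "k \<in> {1..length w}" "l \<in> {1..length w}"
  shows "std w k < std w l
    \<longleftrightarrow> w ! (k - 1) < w ! (l - 1) \<or> w ! (k - 1) = w ! (l - 1) \<and> k < l"
proof -
  let ?A = "\<lambda>k. {l \<in> {1..length w}.
    w ! (l - 1) < w ! (k - 1) \<or> w ! (l - 1) = w ! (k - 1) \<and> l \<le> k}"
  have less: "std w k < std w l"
    if "k \<in> {1..length w}" "l \<in> {1..length w}"
      and "w ! (k - 1) < w ! (l - 1) \<or> w ! (k - 1) = w ! (l - 1) \<and> k < l" for k l
  proof -
    have "?A k \<subset> ?A l" using that by auto
    then have "card (?A k) < card (?A l)" by (intro psubset_card_mono) auto
    then show ?thesis using that unfolding std_def by simp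
  qed
  consider "w ! (k - 1) < w ! (l - 1) \<or> w ! (k - 1) = w ! (l - 1) \<and> k < l" | "k = l"
    | "w ! (l - 1) < w ! (k - 1) \<or> w ! (l - 1) = w ! (k - 1) \<and> l < k"
    by linarith
  then show ?thesis
    by cases (use less [OF assms] less [OF assms(2,1)] in auto)
qed

text \<open>
  A permutation read as a word is its own standardization (\<open>std_permutation_word\<close>). Standardization
  only depends on how a word orders the positions, and \<open>\<sigma>\<close> orders them as \<open>w\<close> does.
\<close>

lemma std_eqI:
  assumes \<sigma>: "\<sigma> permutes {1..length w}"
    and less: "\<And>k l. k \<in> {1..length w} \<Longrightarrow> l \<in> {1..length w} \<Longrightarrow> \<sigma> k < \<sigma> l \<Longrightarrow>
      w ! (k - 1) < w ! (l - 1) \<or> w ! (k - 1) = w ! (l - 1) \<and> k < l"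
  shows "std w = \<sigma>"
proof
  fix k
  let ?n = "length w" and ?s = "map \<sigma> [1..<Suc (length w)]"
  have nth: "?s ! (l - 1) = \<sigma> l" if "l \<in> {1..?n}" for l
    using that by (auto simp del: upt_Suc)
  have inj: "\<sigma> k = \<sigma> l \<longleftrightarrow> k = l" for k l
    using permutes_inj [OF \<sigma>] by (simp add: inj_eq)
  have "std w k = std ?s k"
  proof (cases "k \<in> {1..?n}")
    case True
    have "w ! (l - 1) < w ! (k - 1) \<or> w ! (l - 1) = w ! (k - 1) \<and> l \<le> k
        \<longleftrightarrow> ?s ! (l - 1) < ?s ! (k - 1) \<or> ?s ! (l - 1) = ?s ! (k - 1) \<and> l \<le> k"
      if "l \<in> {1..?n}" for l
    proof -
      consider "\<sigma> l < \<sigma> k" | "\<sigma> k < \<sigma> l" | "l = k"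
        using inj [of l k] by linarith
      then show ?thesis
        unfolding nth [OF that] nth [OF True]
        by cases (use less [OF that True] less [OF True that] in auto)
    qed
    then have "{l \<in> {1..?n}. w ! (l - 1) < w ! (k - 1) \<or> w ! (l - 1) = w ! (k - 1) \<and> l \<le> k}
        = {l \<in> {1..?n}. ?s ! (l - 1) < ?s ! (k - 1) \<or> ?s ! (l - 1) = ?s ! (k - 1) \<and> l \<le> k}"
      by blast
    then show ?thesis
      unfolding std_def by (simp only: length_map length_upt diff_Suc_1)
  qed (auto simp: std_def simp del: upt_Suc)
  then show "std w k = \<sigma> k" by (simp only: std_permutation_word [OF \<sigma>])
qed


section \<open>Multisets of columns and pairs of words with inverse standardizations\<close>

definition inverse_std_pairs :: "(nat list \<times> nat list) set" where
  "inverse_std_pairs = {(u, v). length u = length v \<and> std v = inv (std u)}"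

lemma mset_permuted_list:
  assumes "\<sigma> permutes {1..length xs}"
  shows "mset (map (\<lambda>k. f (xs ! (\<sigma> k - 1))) [1..<Suc (length xs)]) = image_mset f (mset xs)"
proof -
  have "mset (map (\<lambda>k. f (xs ! (\<sigma> k - 1))) [1..<Suc (length xs)])
      = image_mset (\<lambda>k. f (xs ! (k - 1))) (image_mset \<sigma> (mset_set {1..length xs}))"
    by (simp add: mset_map multiset.map_comp comp_def atLeastLessThanSuc_atLeastAtMost
        flip: mset_set_upto_eq_mset_upto del: upt_Suc)
  also have "image_mset \<sigma> (mset_set {1..length xs}) = mset_set {1..length xs}"
    using permutes_inj_on [OF assms] permutes_image [OF assms] by (simp add: image_mset_mset_set)
  also have "image_mset (\<lambda>k. f (xs ! (k - 1))) \<dots>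
      = mset (map (\<lambda>k. f (xs ! (k - 1))) [1..<Suc (length xs)])"
    by (simp add: mset_map atLeastLessThanSuc_atLeastAtMost
        flip: mset_set_upto_eq_mset_upto del: upt_Suc)
  also have "map (\<lambda>k. f (xs ! (k - 1))) [1..<Suc (length xs)] = map f xs"
    by (rule nth_equalityI) (simp_all del: upt_Suc)
  finally show ?thesis by simp
qed

text \<open>
  With \<open>xs\<close> the columns in top-priority order and \<open>\<rho>\<close> the standardization of their bottom row,
  moving each column from position \<open>k\<close> to position \<open>\<rho> k\<close> sorts them by the bottom row. Columns
  with equal bottom entries keep their order, so they stay increasing in the top entry: the
  result is the bottom-priority order.
\<close>

lemma top_row_by_bottom_eq:
  fixes M :: "(nat \<times> nat) multiset"
  defines "xs \<equiv> sorted_list_of_multiset M"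
  defines "\<rho> \<equiv> std (map snd xs)"
  shows "top_row_by_bottom M = map (\<lambda>l. fst (xs ! (inv \<rho> l - 1))) [1..<Suc (length xs)]"
proof -
  let ?n = "length xs"
  let ?ys = "map (\<lambda>l. prod.swap (xs ! (inv \<rho> l - 1))) [1..<Suc ?n]"
  have \<rho>: "\<rho> permutes {1..?n}"
    using std_permutes [of "map snd xs"] by (simp add: \<rho>_def)
  have xs: "sorted xs" by (simp add: xs_def)
  have "sorted ?ys"
    unfolding sorted_iff_nth_mono_less
  proof (intro allI impI)
    fix a b assume "a < b" "b < length ?ys"
    then have ab: "a < b" "b < ?n" by (simp_all del: upt_Suc)
    define k l where "k = inv \<rho> (Suc a)" and "l = inv \<rho> (Suc b)"
    have kl: "k \<in> {1..?n}" "l \<in> {1..?n}"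
      unfolding k_def l_def permutes_in_image [OF permutes_inv [OF \<rho>]] using ab by auto
    have "\<rho> k < \<rho> l"
      unfolding k_def l_def using ab by (simp add: permutes_inverses [OF \<rho>])
    then have less: "snd (xs ! (k - 1)) < snd (xs ! (l - 1))
        \<or> snd (xs ! (k - 1)) = snd (xs ! (l - 1)) \<and> k < l"
      using kl std_less_iff [of k "map snd xs" l] by (auto simp: \<rho>_def)
    moreover have "xs ! (k - 1) \<le> xs ! (l - 1)" if "k < l"
      using xs that kl by (intro sorted_nth_mono) auto
    ultimately have "prod.swap (xs ! (k - 1)) \<le> prod.swap (xs ! (l - 1))"
      unfolding less_eq_prod_def fst_swap snd_swap by fastforce
    then show "?ys ! a \<le> ?ys ! b"
      using ab by (simp add: k_def l_def del: upt_Suc)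
  qed
  moreover have "mset ?ys = image_mset prod.swap M"
    using mset_permuted_list [OF permutes_inv [OF \<rho>], of prod.swap] by (simp add: xs_def del: upt_Suc)
  ultimately have "sorted_list_of_multiset (image_mset prod.swap M) = ?ys"
    using sorted_list_of_multiset_mset [of ?ys] by (simp only: sorted_sort_id)
  then show ?thesis by (simp add: top_row_by_bottom_def comp_def del: upt_Suc)
qed

text \<open>
  Writing \<open>\<rho> = std v'\<close>, the word \<open>u''\<close> lists the top entries in the order \<open>inv \<rho>\<close>. Among equal top
  entries the bottom entries increase weakly with the position in the top-priority order, so
  \<open>\<rho>\<close> is increasing there; thus equal letters of \<open>u''\<close> are labelled from left to right, as
  \<open>std_eqI\<close> requires.
\<close>

lemma std_bracket_rows:
  "(top_row_by_bottom M, bottom_row_by_top M) \<in> inverse_std_pairs"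
proof -
  define xs where "xs = sorted_list_of_multiset M"
  define \<rho> where "\<rho> = std (map snd xs)"
  let ?n = "length xs"
  let ?u = "top_row_by_bottom M"
  have u: "?u = map (\<lambda>l. fst (xs ! (inv \<rho> l - 1))) [1..<Suc ?n]"
    unfolding \<rho>_def xs_def by (rule top_row_by_bottom_eq)
  have len: "length ?u = ?n" by (simp add: u del: upt_Suc)
  have nth: "?u ! (l - 1) = fst (xs ! (inv \<rho> l - 1))" if "l \<in> {1..?n}" for l
    using that by (auto simp: u simp del: upt_Suc)
  have \<rho>: "\<rho> permutes {1..?n}"
    using std_permutes [of "map snd xs"] by (simp add: \<rho>_def)
  have xs: "sorted xs" by (simp add: xs_def)
  have "std ?u = inv \<rho>"
  proof (rule std_eqI)
    show "inv \<rho> permutes {1..length ?u}"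
      unfolding len by (rule permutes_inv [OF \<rho>])
  next
    fix a b assume ab: "a \<in> {1..length ?u}" "b \<in> {1..length ?u}" and less: "inv \<rho> a < inv \<rho> b"
    define k l where "k = inv \<rho> a" and "l = inv \<rho> b"
    have kl: "k \<in> {1..?n}" "l \<in> {1..?n}"
      unfolding k_def l_def permutes_in_image [OF permutes_inv [OF \<rho>]] using ab
      by (simp_all add: len)
    have a: "\<rho> k = a" "\<rho> l = b"
      unfolding k_def l_def by (simp_all add: permutes_inverses [OF \<rho>])
    have "k < l" using less by (simp add: k_def l_def)
    then have le: "xs ! (k - 1) \<le> xs ! (l - 1)"
      using xs kl by (intro sorted_nth_mono) auto
    have "a < b" if "snd (xs ! (k - 1)) \<le> snd (xs ! (l - 1))"
      using that \<open>k < l\<close> kl std_less_iff [of k "map snd xs" l] unfolding a [symmetric]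
      by (auto simp: \<rho>_def)
    moreover have "?u ! (a - 1) = fst (xs ! (k - 1))" "?u ! (b - 1) = fst (xs ! (l - 1))"
      using ab nth [of a] nth [of b] unfolding len k_def l_def by blast+
    ultimately show "?u ! (a - 1) < ?u ! (b - 1) \<or> ?u ! (a - 1) = ?u ! (b - 1) \<and> a < b"
      using le unfolding less_eq_prod_def by fastforce
  qed
  moreover have "bottom_row_by_top M = map snd xs"
    by (simp add: bottom_row_by_top_def xs_def)
  ultimately show ?thesis
    using len permutes_inv_inv [OF \<rho>] by (simp add: inverse_std_pairs_def \<rho>_def)
qed

text \<open>
  The words \<open>u''\<close> and \<open>u'\<close> have the same letters, and \<open>u'\<close> is increasing, so \<open>u'\<close> is \<open>u''\<close> sorted.
  Stated as an equation for \<open>M\<close>, this shows that \<open>M \<mapsto> (u'', v')\<close> is injective.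
\<close>

lemma bracket_rows_determine:
  "M = mset (zip (sort (top_row_by_bottom M)) (bottom_row_by_top M))"
proof -
  let ?xs = "sorted_list_of_multiset M"
  have "mset (map fst ?xs) = mset (top_row_by_bottom M)"
    by (simp add: top_row_by_bottom_def mset_map multiset.map_comp comp_def)
  moreover have "sorted (map fst ?xs)"
  proof -
    have "sorted ?xs" by simp
    then show ?thesis
      unfolding sorted_map by (rule sorted_wrt_mono_rel [rotated]) (auto simp: less_eq_prod_def)
  qed
  ultimately have "sort (top_row_by_bottom M) = map fst ?xs"
    by (metis properties_for_sort)
  then show ?thesis by (simp add: bottom_row_by_top_def zip_map_fst_snd)
qed

text \<open>
  The top row of the witness is \<open>u\<close> sorted, since \<open>std v\<close> is the inverse of \<open>std u\<close>; this form
  avoids sorting and makes the lexicographic order of the columns a matter of comparing labels.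
\<close>

lemma bracket_rows_surj:
  assumes "(u, v) \<in> inverse_std_pairs"
  shows "\<exists>M. top_row_by_bottom M = u \<and> bottom_row_by_top M = v"
proof -
  let ?n = "length v"
  have len: "length u = ?n" and std: "std v = inv (std u)"
    using assms by (auto simp: inverse_std_pairs_def)
  have v: "std v permutes {1..?n}" by (rule std_permutes)
  have u: "std u permutes {1..?n}" using std_permutes [of u] by (simp add: len)
  let ?xs = "map (\<lambda>k. (u ! (std v k - 1), v ! (k - 1))) [1..<Suc ?n]"
  let ?M = "mset ?xs"
  have "sorted ?xs"
    unfolding sorted_iff_nth_mono_less
  proof (intro allI impI)
    fix a b assume "a < b" "b < length ?xs"
    then have ab: "a < b" "b < ?n" by (simp_all del: upt_Suc)
    define k l where "k = std v (Suc a)" and "l = std v (Suc b)"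
    have kl: "k \<in> {1..?n}" "l \<in> {1..?n}"
      unfolding k_def l_def permutes_in_image [OF v] using ab by auto
    have "std u k < std u l"
      unfolding k_def l_def std using ab by (simp add: permutes_inverses [OF u])
    then have "u ! (k - 1) < u ! (l - 1) \<or> u ! (k - 1) = u ! (l - 1) \<and> k < l"
      using kl std_less_iff [of k u l] by (simp add: len)
    moreover have "v ! a \<le> v ! b" if "k < l"
      using that ab std_less_iff [of "Suc a" v "Suc b"] by (auto simp: k_def l_def)
    ultimately show "?xs ! a \<le> ?xs ! b"
      using ab by (auto simp: k_def l_def less_eq_prod_def simp del: upt_Suc)
  qed
  then have xs: "sorted_list_of_multiset ?M = ?xs"
    by (simp only: sorted_list_of_multiset_mset sorted_sort_id)
  have "map snd ?xs = v"
    by (rule nth_equalityI) (simp_all del: upt_Suc)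
  then have "bottom_row_by_top ?M = v"
    by (simp only: bottom_row_by_top_def xs)
  moreover have "top_row_by_bottom ?M = u"
  proof -
    have "top_row_by_bottom ?M
        = map (\<lambda>l. fst (?xs ! (inv (std v) l - 1))) [1..<Suc ?n]"
      unfolding top_row_by_bottom_eq xs \<open>map snd ?xs = v\<close> by (simp del: upt_Suc)
    also have "\<dots> = u"
    proof (rule nth_equalityI)
      fix a assume "a < length (map (\<lambda>l. fst (?xs ! (inv (std v) l - 1))) [1..<Suc ?n])"
      then have a: "a < ?n" by (simp del: upt_Suc)
      define k where "k = inv (std v) (Suc a)"
      have k: "k \<in> {1..?n}"
        unfolding k_def permutes_in_image [OF permutes_inv [OF v]] using a by simp
      have "std v k = Suc a" by (simp add: k_def permutes_inverses [OF v])
      then have "fst (?xs ! (k - 1)) = u ! a"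
        using k by (auto simp del: upt_Suc)
      then show "map (\<lambda>l. fst (?xs ! (inv (std v) l - 1))) [1..<Suc ?n] ! a = u ! a"
        using a by (simp add: k_def del: upt_Suc)
    qed (simp add: len del: upt_Suc)
    finally show ?thesis .
  qed
  ultimately show ?thesis by blast
qed


section \<open>Sums of indicator series\<close>

text \<open>
  The bracketed Cauchy product, the sum over pairs of words and the sum over the \<open>F\<^sub>\<sigma> \<otimes> G\<^sub>\<sigma>\<close> are
  all sums of indicator series of disjoint sets; they differ only in the partition.
\<close>

lemma formal_has_sum_partition:
  fixes f :: "'i \<Rightarrow> ('m, 'k::{ab_group_add,zero_neq_one}) series"
  assumes f: "\<And>i m. i \<in> I \<Longrightarrow> coeff (f i) m = (if m \<in> A i then 1 else 0)"
    and disjoint: "disjoint_family_on A I"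
  shows "formal_has_sum f I (Series (\<lambda>m. if m \<in> (\<Union>i\<in>I. A i) then 1 else 0))"
proof (rule formal_has_sumI)
  fix m
  let ?T = "{i \<in> I. coeff (f i) m \<noteq> 0}"
  have T: "?T = {i \<in> I. m \<in> A i}" using f by (auto split: if_splits)
  consider "?T = {}" "m \<notin> (\<Union>i\<in>I. A i)" | j where "?T = {j}" "j \<in> I" "m \<in> A j"
    using disjoint unfolding T disjoint_family_on_def by blast
  then have "finite ?T \<and>
      coeff (Series (\<lambda>m. if m \<in> (\<Union>i\<in>I. A i) then 1 else 0)) m = (\<Sum>i\<in>?T. coeff (f i) m)"
  proof cases
    case 1
    then show ?thesis unfolding 1(1) by simp
  next
    case (2 j)
    then show ?thesis unfolding 2(1) using f [OF 2(2)] by auto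
  qed
  then show "finite ?T"
    and "coeff (Series (\<lambda>m. if m \<in> (\<Union>i\<in>I. A i) then 1 else 0)) m = (\<Sum>i\<in>?T. coeff (f i) m)"
    by blast+
qed

definition cauchy_kernel :: "'k::field_char_0 tensor_series" where
  "cauchy_kernel = Series (\<lambda>m. if m \<in> inverse_std_pairs then 1 else 0)"

lemma coeff_tensor [simp]: "coeff (f \<otimes> g) (u, v) = coeff f u * coeff g v"
  by (simp add: tensor_def)

lemma bracket_cauchy_product: "bracket (Series (\<lambda>_. 1)) = cauchy_kernel"
  unfolding bracket_def
proof (rule formal_sum_eqI)
  let ?A = "\<lambda>M. {(top_row_by_bottom M, bottom_row_by_top M)}"
  have union: "(\<Union>M. ?A M) = inverse_std_pairs"
    using std_bracket_rows bracket_rows_surj by (auto simp: image_iff) metis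
  have disjoint: "disjoint_family ?A"
    unfolding disjoint_family_on_def using bracket_rows_determine
    by (metis (no_types, lifting) Int_emptyI prod.inject singletonD)
  have coeff: "coeff (scale (coeff (Series (\<lambda>_. 1)) M)
      (monomial (top_row_by_bottom M) \<otimes> monomial (bottom_row_by_top M)) :: 'a tensor_series) m
      = (if m \<in> ?A M then 1 else 0)" for M m
    by (cases m) auto
  have "formal_has_sum (\<lambda>M. scale (coeff (Series (\<lambda>_. 1)) M)
      (monomial (top_row_by_bottom M) \<otimes> monomial (bottom_row_by_top M)) :: 'a tensor_series) UNIV
      (Series (\<lambda>m. if m \<in> (\<Union>M. ?A M) then 1 else 0))"
    by (rule formal_has_sum_partition) (rule coeff, rule disjoint)
  then show "formal_has_sum (\<lambda>M. scale (coeff (Series (\<lambda>_. 1)) M)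
      (monomial (top_row_by_bottom M) \<otimes> monomial (bottom_row_by_top M))) UNIV
      (cauchy_kernel :: 'a tensor_series)"
    unfolding union cauchy_kernel_def .
qed

lemma cauchy_kernel_words:
  "formal_has_sum (\<lambda>(u, v). monomial u \<otimes> monomial v) inverse_std_pairs
     (cauchy_kernel :: 'k::field_char_0 tensor_series)"
proof -
  let ?A = "\<lambda>m :: nat list \<times> nat list. {m}"
  have "formal_has_sum (\<lambda>(u, v). monomial u \<otimes> monomial v :: 'k tensor_series) inverse_std_pairs
      (Series (\<lambda>m. if m \<in> (\<Union>i\<in>inverse_std_pairs. ?A i) then 1 else 0))"
    by (rule formal_has_sum_partition) (auto simp: disjoint_family_on_def split: if_splits)
  then show ?thesis by (simp add: cauchy_kernel_def)
qed

lemma cauchy_kernel_F_G: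
  "formal_has_sum (\<lambda>(n, \<sigma>). F n \<sigma> \<otimes> G n \<sigma>) Perms
     (cauchy_kernel :: 'k::field_char_0 tensor_series)"
proof -
  let ?A = "\<lambda>(n, \<sigma>). {(u, v). length u = n \<and> length v = n \<and> std u = inv \<sigma> \<and> std v = \<sigma>}"
  have "(u, v) \<in> (\<Union>s\<in>Perms. ?A s) \<longleftrightarrow> (u, v) \<in> inverse_std_pairs" for u v
  proof
    assume "(u, v) \<in> (\<Union>s\<in>Perms. ?A s)"
    then show "(u, v) \<in> inverse_std_pairs"
      by (auto simp: inverse_std_pairs_def Perms_def permutes_inv_inv)
  next
    assume uv: "(u, v) \<in> inverse_std_pairs"
    then have "std u = inv (std v)"
      using permutes_inv_inv [OF std_permutes [of u]] by (simp add: inverse_std_pairs_def)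
    with uv show "(u, v) \<in> (\<Union>s\<in>Perms. ?A s)"
      using std_permutes [of v]
      by (intro UN_I [of "(length v, std v)"]) (auto simp: inverse_std_pairs_def Perms_def)
  qed
  then have "(\<Union>s\<in>Perms. ?A s) = inverse_std_pairs" by auto
  moreover have "formal_has_sum (\<lambda>(n, \<sigma>). F n \<sigma> \<otimes> G n \<sigma> :: 'k tensor_series) Perms
      (Series (\<lambda>m. if m \<in> (\<Union>s\<in>Perms. ?A s) then 1 else 0))"
    by (rule formal_has_sum_partition) (auto simp: disjoint_family_on_def split: if_splits)
  ultimately show ?thesis by (simp add: cauchy_kernel_def)
qed


section \<open>Adjoint bases\<close>

lemma basis_expansion:
  fixes B :: "nat \<Rightarrow> (nat \<Rightarrow> nat) \<Rightarrow> 'k::field_char_0 ncseries"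
  assumes inj: "inj_on (\<lambda>(n, \<sigma>). B n \<sigma>) Perms"
    and indep: "series.independent ((\<lambda>(n, \<sigma>). B n \<sigma>) ` Perms)"
    and f: "f \<in> series.span ((\<lambda>(n, \<sigma>). B n \<sigma>) ` Perms)"
  shows "finite {s \<in> Perms. basis_coord B f s \<noteq> 0}" (is "finite ?T")
    and "f = (\<Sum>s | s \<in> Perms \<and> basis_coord B f s \<noteq> 0. scale (basis_coord B f s) (case_prod B s))"
proof -
  let ?b = "\<lambda>(n, \<sigma>). B n \<sigma>"
  let ?r = "series.representation (?b ` Perms) f"
  have coord: "basis_coord B f s = ?r (?b s)" for s
    by (simp add: basis_coord_def case_prod_unfold)
  have image: "{b. ?r b \<noteq> 0} = ?b ` ?T"
    using series.representation_ne_zero [of "?b ` Perms" f] unfolding coord by auto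
  have inj': "inj_on ?b ?T" using inj by (rule inj_on_subset) auto
  show "finite ?T"
    using series.finite_representation [of "?b ` Perms" f] unfolding image
    by (rule finite_imageD) (rule inj')
  have "f = (\<Sum>b | ?r b \<noteq> 0. scale (?r b) b)"
    using series.sum_nonzero_representation_eq [OF indep f] by simp
  also have "\<dots> = (\<Sum>s\<in>?T. scale (basis_coord B f s) (case_prod B s))"
    unfolding image sum.reindex [OF inj'] by (simp add: coord comp_def)
  finally show "f = (\<Sum>s\<in>?T. scale (basis_coord B f s) (case_prod B s))" .
qed

text \<open>
  To be used with \<open>B = F\<close>: this basis consists of indicator series of disjoint sets of words, so every word \<open>w\<close>
  occurs in exactly one basis element, and its coefficient in \<open>f\<close> is a coordinate of \<open>f\<close>.
\<close>

lemma coeff_eq_basis_coord: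
  fixes B :: "nat \<Rightarrow> (nat \<Rightarrow> nat) \<Rightarrow> 'k::field_char_0 ncseries"
  assumes "inj_on (\<lambda>(n, \<sigma>). B n \<sigma>) Perms"
    and "series.independent ((\<lambda>(n, \<sigma>). B n \<sigma>) ` Perms)"
    and "f \<in> series.span ((\<lambda>(n, \<sigma>). B n \<sigma>) ` Perms)"
    and t: "t \<in> Perms"
    and B: "\<And>s. s \<in> Perms \<Longrightarrow> coeff (case_prod B s) w = (if s = t then 1 else 0)"
  shows "coeff f w = basis_coord B f t"
proof -
  let ?T = "{s \<in> Perms. basis_coord B f s \<noteq> 0}"
  note expansion = basis_expansion [OF assms(1-3)]
  have "coeff f w = (\<Sum>s\<in>?T. basis_coord B f s * coeff (case_prod B s) w)"
    by (subst expansion(2)) simp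
  also have "\<dots> = (\<Sum>s\<in>?T. if s = t then basis_coord B f s else 0)"
    by (rule sum.cong) (auto simp: B)
  also have "\<dots> = basis_coord B f t"
    using expansion(1) t by (simp add: sum.delta)
  finally show ?thesis .
qed

lemma span_F: "series.span ((\<lambda>(n, \<sigma>). F n \<sigma>) ` Perms) = (FQSym :: 'k::field_char_0 ncseries set)"
  unfolding FQSym_def by (rule arg_cong [where f = series.span]) (auto simp: Perms_def image_iff)

lemma span_G: "series.span ((\<lambda>(n, \<sigma>). G n \<sigma>) ` Perms) = (FQSym :: 'k::field_char_0 ncseries set)"
  using span_F unfolding F_image_eq_G_image .

lemma independent_F:
  "series.independent ((\<lambda>(n, \<sigma>). F n \<sigma> :: 'k::field_char_0 ncseries) ` Perms)"
  unfolding F_image_eq_G_image by (rule independent_G)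

text \<open>
  Pairing with \<open>G\<^sub>\<beta>\<close> extracts the \<open>F\<^sub>\<beta>\<close>-coordinate, and for \<open>\<beta> = (std w)\<^sup>-\<^sup>1\<close> the series \<open>F\<^sub>\<beta>\<close> is the one
  that contains \<open>w\<close>.
\<close>

lemma fqsym_inner_G:
  fixes f :: "'k::field_char_0 ncseries"
  assumes f: "f \<in> FQSym"
  shows "fqsym_inner f (G (length w) (inv (std w))) = coeff f w"
proof -
  let ?t = "(length w, inv (std w))"
  have t: "?t \<in> Perms"
    using permutes_inv [OF std_permutes [of w]] by (simp add: Perms_def)
  have F: "coeff (case_prod F s :: 'k ncseries) w = (if s = ?t then 1 else 0)"
    if Perms: "s \<in> Perms" for s
  proof -
    obtain n \<sigma> where s: "s = (n, \<sigma>)" and \<sigma>: "\<sigma> permutes {1..n}"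
      using Perms by (auto simp: Perms_def)
    have "std w = inv \<sigma> \<longleftrightarrow> \<sigma> = inv (std w)"
      using permutes_inv_inv [OF \<sigma>] permutes_inv_inv [OF std_permutes [of w]] by metis
    then show ?thesis by (simp add: s eq_commute [of n] conj_commute)
  qed
  have fin: "finite {s \<in> Perms. basis_coord F f s \<noteq> 0}"
    using basis_expansion(1) [OF inj_on_F independent_F] f unfolding span_F .
  have G: "basis_coord G (G (length w) (inv (std w)) :: 'k ncseries) s = (if s = ?t then 1 else 0)"
    if "s \<in> Perms" for s
    using inj_on_G independent_G that t by (rule basis_coord_self)
  have "fqsym_inner f (G (length w) (inv (std w)))
      = (\<Sum>s | s \<in> Perms \<and> basis_coord F f s \<noteq> 0. if s = ?t then basis_coord F f s else 0)"
    unfolding fqsym_inner_def by (rule sum.cong) (auto simp: G)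
  also have "\<dots> = basis_coord F f ?t"
    using fin t by (simp add: sum.delta)
  also have "\<dots> = coeff f w"
    using coeff_eq_basis_coord [OF inj_on_F independent_F _ t F] f unfolding span_F by simp
  finally show ?thesis .
qed

lemma fqsym_inner_sum_right:
  fixes f :: "'k::field_char_0 ncseries"
  assumes "\<And>i. i \<in> I \<Longrightarrow> g i \<in> FQSym"
  shows "fqsym_inner f (\<Sum>i\<in>I. scale (c i) (g i)) = (\<Sum>i\<in>I. c i * fqsym_inner f (g i))"
proof -
  let ?B = "(\<lambda>(n, \<sigma>). G n \<sigma> :: 'k ncseries) ` Perms"
  have g: "g i \<in> series.span ?B" if "i \<in> I" for i
    unfolding span_G using that by (rule assms)
  have "basis_coord G (\<Sum>i\<in>I. scale (c i) (g i)) s = (\<Sum>i\<in>I. c i * basis_coord G (g i) s)" for s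
  proof -
    have "series.representation ?B (\<Sum>i\<in>I. scale (c i) (g i))
        = (\<lambda>b. \<Sum>i\<in>I. series.representation ?B (scale (c i) (g i)) b)"
      by (intro series.representation_sum independent_G series.span_scale g)
    also have "\<dots> = (\<lambda>b. \<Sum>i\<in>I. c i * series.representation ?B (g i) b)"
      by (intro ext sum.cong refl) (simp only: series.representation_scale [OF independent_G g])
    finally show ?thesis by (simp add: basis_coord_def case_prod_unfold)
  qed
  then show ?thesis
    by (simp add: fqsym_inner_def sum_distrib_left mult.left_commute sum.swap [of _ I])
qed

lemma basis_coord_eq_fqsym_inner:
  fixes P Q :: "nat \<Rightarrow> (nat \<Rightarrow> nat) \<Rightarrow> 'k::field_char_0 ncseries"
  assumes PQ: "adjoint_bases P Q" and g: "g \<in> FQSym" and s: "s \<in> Perms"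
  shows "basis_coord Q g s = fqsym_inner (case_prod P s) g"
proof -
  let ?T = "{t \<in> Perms. basis_coord Q g t \<noteq> 0}"
  have Q: "inj_on (\<lambda>(n, \<sigma>). Q n \<sigma>) Perms" "series.independent ((\<lambda>(n, \<sigma>). Q n \<sigma>) ` Perms)"
      "series.span ((\<lambda>(n, \<sigma>). Q n \<sigma>) ` Perms) = FQSym"
    using PQ unfolding adjoint_bases_def homogeneous_basis_def by auto
  have dual: "fqsym_inner (case_prod P s) (case_prod Q t) = (if s = t then 1 else 0)"
    if "t \<in> Perms" for t
    using PQ s that unfolding adjoint_bases_def by (cases s; cases t) fastforce
  have "g \<in> series.span ((\<lambda>(n, \<sigma>). Q n \<sigma>) ` Perms)" using g by (simp add: Q(3))
  note expansion = basis_expansion [OF Q(1,2) this]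
  have "case_prod Q t \<in> FQSym" if "t \<in> Perms" for t
    unfolding Q(3) [symmetric] using that by (intro series.span_base) (auto simp: image_iff)
  then have "fqsym_inner (case_prod P s) g
      = (\<Sum>t\<in>?T. basis_coord Q g t * fqsym_inner (case_prod P s) (case_prod Q t))"
    by (subst expansion(2)) (rule fqsym_inner_sum_right, simp)
  also have "\<dots> = (\<Sum>t\<in>?T. if s = t then basis_coord Q g t else 0)"
    by (rule sum.cong) (auto simp: dual)
  also have "\<dots> = basis_coord Q g s"
    using expansion(1) s by (simp add: sum.delta')
  finally show ?thesis by simp
qed

lemma cauchy_kernel_adjoint:
  fixes P Q :: "nat \<Rightarrow> (nat \<Rightarrow> nat) \<Rightarrow> 'k::field_char_0 ncseries"
  assumes PQ: "adjoint_bases P Q"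
  shows "formal_has_sum (\<lambda>(n, \<sigma>). P n \<sigma> \<otimes> Q n \<sigma>) Perms cauchy_kernel"
proof (rule formal_has_sumI)
  fix m :: "nat list \<times> nat list"
  obtain u v where m: "m = (u, v)" by (cases m)
  \<comment> \<open>The coordinates of this series in the basis \<open>Q\<close> are the coefficients of \<open>u\<close> in the \<open>P\<^sub>\<sigma>\<close>.\<close>
  let ?g = "G (length u) (inv (std u)) :: 'k ncseries"
  let ?c = "basis_coord Q ?g"
  let ?S = "{s \<in> Perms. ?c s \<noteq> 0}"
  let ?T = "{s \<in> Perms. coeff (case s of (n, \<sigma>) \<Rightarrow> P n \<sigma> \<otimes> Q n \<sigma>) m \<noteq> 0}"
  have P: "series.span ((\<lambda>(n, \<sigma>). P n \<sigma>) ` Perms) = FQSym"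
    and Q: "inj_on (\<lambda>(n, \<sigma>). Q n \<sigma>) Perms" "series.independent ((\<lambda>(n, \<sigma>). Q n \<sigma>) ` Perms)"
      "series.span ((\<lambda>(n, \<sigma>). Q n \<sigma>) ` Perms) = FQSym"
    using PQ unfolding adjoint_bases_def homogeneous_basis_def by auto
  have g: "?g \<in> FQSym"
    unfolding span_G [symmetric] using permutes_inv [OF std_permutes [of u]]
    by (intro series.span_base) (auto simp: Perms_def image_iff)
  have coeff_P: "coeff (case_prod P s) u = ?c s" if "s \<in> Perms" for s
  proof -
    have "case_prod P s \<in> FQSym"
      unfolding P [symmetric] using that by (intro series.span_base) (auto simp: image_iff)
    then have "fqsym_inner (case_prod P s) ?g = coeff (case_prod P s) u"
      by (rule fqsym_inner_G)
    then show ?thesis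
      using basis_coord_eq_fqsym_inner [OF PQ g that] by simp
  qed
  have coeff_PQ: "coeff (case s of (n, \<sigma>) \<Rightarrow> P n \<sigma> \<otimes> Q n \<sigma>) m = ?c s * coeff (case_prod Q s) v"
    if "s \<in> Perms" for s
    using coeff_P [OF that] by (cases s) (simp add: m)
  have "?g \<in> series.span ((\<lambda>(n, \<sigma>). Q n \<sigma>) ` Perms)" using g by (simp add: Q(3))
  note expansion = basis_expansion [OF Q(1,2) this]
  have TS: "?T \<subseteq> ?S" using coeff_PQ by auto
  then show "finite ?T" using expansion(1) by (rule finite_subset)
  have "coeff cauchy_kernel m = coeff ?g v"
    by (auto simp: m cauchy_kernel_def inverse_std_pairs_def)
  also have "\<dots> = (\<Sum>s\<in>?S. ?c s * coeff (case_prod Q s) v)"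
    by (subst expansion(2)) (simp del: coeff_G)
  also have "\<dots> = (\<Sum>s\<in>?S. coeff (case s of (n, \<sigma>) \<Rightarrow> P n \<sigma> \<otimes> Q n \<sigma>) m)"
    by (rule sum.cong) (simp_all add: coeff_PQ)
  also have "\<dots> = (\<Sum>s\<in>?T. coeff (case s of (n, \<sigma>) \<Rightarrow> P n \<sigma> \<otimes> Q n \<sigma>) m)"
    using expansion(1) TS by (intro sum.mono_neutral_right) auto
  finally show "coeff cauchy_kernel m
      = (\<Sum>s\<in>?T. coeff (case s of (n, \<sigma>) \<Rightarrow> P n \<sigma> \<otimes> Q n \<sigma>) m)" .
qed

theorem proposition4p2:
  fixes P Q :: "nat \<Rightarrow> (nat \<Rightarrow> nat) \<Rightarrow> 'k::field_char_0 ncseries"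
  assumes "adjoint_bases P Q"
  shows "formal_multipliable (\<lambda>(i, j). 1 / (1 - X i j) :: 'k xseries) UNIV \<and>
    (let Z = bracket (formal_prod (\<lambda>(i, j). 1 / (1 - X i j) :: 'k xseries) UNIV) in
      formal_has_sum (\<lambda>(u, v). monomial u \<otimes> monomial v)
        {(u, v). length u = length v \<and> std v = inv (std u)} Z \<and>
      formal_has_sum (\<lambda>(n, \<sigma>). F n \<sigma> \<otimes> G n \<sigma>) Perms Z \<and>
      formal_has_sum (\<lambda>(n, \<sigma>). P n \<sigma> \<otimes> Q n \<sigma>) Perms Z)"
proof -
  have "bracket (formal_prod (\<lambda>(i, j). 1 / (1 - X i j) :: 'k xseries) UNIV) = cauchy_kernel"
    by (simp only: formal_prod_eqI [OF cauchy_product] bracket_cauchy_product)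
  then show ?thesis
    unfolding Let_def formal_multipliable_def
    using cauchy_product cauchy_kernel_words cauchy_kernel_F_G cauchy_kernel_adjoint [OF assms]
    by (auto simp: inverse_std_pairs_def)
qed

end
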